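(* Both classes $\operatorname{NSpec}_{\mathrm{fr}}$ and $\operatorname{NSpec}_{\mathrm{sp}}$ are upward closed (if $\lambda$ belongs to the class and $\kappa\ge\lambda$ is a cardinal, then $\kappa$ belongs to the class). In particular, $$\operatorname{NSpec}_{\mathrm{fr}}=\{\kappa:\kappa\text{ is a cardinal and }\kappa\ge\mathfrak s_{\mathrm{fr}}\},\qquad \operatorname{NSpec}_{\mathrm{sp}}=\{\kappa:\kappa\text{ is a cardinal and }\kappa\ge\mathfrak s_{\mathrm{sp}}\}.$$
   Context: A frame is a complete lattice $L$ with $a\wedge\bigvee S=\bigvee_{s\in S}(a\wedge s)$ for all $a\in L$, $S\subseteq L$. It is spatial if it is isomorphic to the lattice of open sets of some topological space. $\Sigma L$ denotes $L$ with the Scott topology, whose open sets are the upper sets $U$ such that every directed $D$ with $\bigvee D\in U$ meets $U$. A $T_0$ space is sober if every (nonempty) irreducible closed subset is the closure of a unique point. $\operatorname{NSpec}_{\mathrm{fr}}$ is the class of infinite cardinals $\kappa$ for which there is a frame $L$ with $|L|=\kappa$ and $\Sigma L$ non-sober; $\operatorname{NSpec}_{\mathrm{sp}}$ is the corresponding class with $L$ additionally required to be spatial. Both classes are nonempty, and $\mathfrak s_{\mathrm{fr}}=\min\operatorname{NSpec}_{\mathrm{fr}}$, $\mathfrak s_{\mathrm{sp}}=\min\operatorname{NSpec}_{\mathrm{sp}}$. *)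

theory Defs
  imports "HOL-Algebra.Complete_Lattice" "HOL-Analysis.Abstract_Topological_Spaces"
begin

unbundle cardinal_syntax

(* these clash with cardinal equality and with the topological closure operator *)
no_notation elt_set_eq (infix \<open>=o\<close> 50)
no_notation eq_closure_of (\<open>closure'_of\<index>\<close>)

section \<open>Frames and spatial frames\<close>

locale frame = complete_lattice L for L (structure) +
  assumes inf_Sup_distrib:
    "\<lbrakk>a \<in> carrier L; S \<subseteq> carrier L\<rbrakk> \<Longrightarrow> a \<sqinter> \<Squnion>S = \<Squnion>((\<lambda>s. a \<sqinter> s) ` S)"

definition opens_lattice :: "'p topology \<Rightarrow> 'p set gorder" where
  "opens_lattice X = \<lparr>carrier = {U. openin X U}, eq = (=), le = (\<subseteq>)\<rparr>"

lemma partial_order_opens_lattice: "partial_order (opens_lattice X)"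
  by unfold_locales (auto simp: opens_lattice_def)

text \<open>
  The definition below ranges over spaces whose points have type \<open>'a set\<close>.  This is no restriction:
  a point may be replaced by the set of those elements of \<open>L\<close> whose open set contains it, see
  \<open>spatialI\<close>.
\<close>

definition spatial :: "('a, 'm) gorder_scheme \<Rightarrow> bool" where
  "spatial L \<longleftrightarrow>
     (\<exists>(X :: 'a set topology) f.
        bij_betw f (carrier L) (carrier (opens_lattice X)) \<and> order_emb L (opens_lattice X) f)"

lemma spatialI:
  fixes L :: "('a, 'm) gorder_scheme" and X :: "'p topology"
  assumes bij: "bij_betw f (carrier L) (carrier (opens_lattice X))"
    and emb: "order_emb L (opens_lattice X) f"
  shows "spatial L"
proof -
  define g where "g p = {x \<in> carrier L. p \<in> f x}" for p
  define h where "h x = {P \<in> g ` topspace X. x \<in> P}" for x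
  define T where "T = (\<lambda>V. \<exists>x\<in>carrier L. V = h x)"
  have f_carrier: "f ` carrier L = {U. openin X U}"
    using bij by (simp add: bij_betw_def opens_lattice_def)
  have op: "openin X (f x)" if "x \<in> carrier L" for x
    using f_carrier that by blast
  have h_iff: "g p \<in> h x \<longleftrightarrow> p \<in> f x" if "x \<in> carrier L" "p \<in> topspace X" for x p
    using that by (auto simp: h_def g_def)
  have h_sub: "h x \<subseteq> g ` topspace X" for x
    by (auto simp: h_def)
  have f_surj: "\<exists>x\<in>carrier L. f x = U" if "openin X U" for U
  proof -
    from that have "U \<in> f ` carrier L"
      by (simp add: f_carrier)
    then show ?thesis by blast
  qed
  have h_mono: "h x \<subseteq> h y \<longleftrightarrow> f x \<subseteq> f y" if "x \<in> carrier L" "y \<in> carrier L" for x y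
  proof -
    have "h x \<subseteq> h y \<longleftrightarrow> (\<forall>p\<in>topspace X. g p \<in> h x \<longrightarrow> g p \<in> h y)"
      by (auto simp: h_def)
    also have "\<dots> \<longleftrightarrow> (\<forall>p\<in>topspace X. p \<in> f x \<longrightarrow> p \<in> f y)"
      using h_iff that by simp
    also have "\<dots> \<longleftrightarrow> f x \<subseteq> f y"
      using openin_subset[OF op[OF that(1)]] by auto
    finally show ?thesis .
  qed
  have "istopology T"
    unfolding istopology_def
  proof (intro conjI allI impI)
    fix U V assume "T U" "T V"
    then obtain x y where xy: "x \<in> carrier L" "U = h x" "y \<in> carrier L" "V = h y"
      by (auto simp: T_def)
    obtain z where z: "z \<in> carrier L" "f z = f x \<inter> f y"
      using f_surj[of "f x \<inter> f y"] op xy by auto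
    have *: "P \<in> U \<inter> V \<longleftrightarrow> P \<in> h z" for P
    proof (cases "P \<in> g ` topspace X")
      case True
      then obtain p where p: "p \<in> topspace X" "P = g p" by auto
      show ?thesis
        using h_iff[OF z(1) p(1)] h_iff[OF xy(1) p(1)] h_iff[OF xy(3) p(1)] z(2) p(2) xy(2,4) by simp
    next
      case False
      then show ?thesis using xy(2,4) by (simp add: h_def)
    qed
    show "T (U \<inter> V)"
      unfolding T_def using z(1) Set.set_eqI[OF *] by (intro bexI[of _ z])
  next
    fix K assume K: "\<forall>V\<in>K. T V"
    then have "\<forall>V\<in>K. \<exists>x. x \<in> carrier L \<and> V = h x"
      by (simp only: T_def Bex_def)
    from bchoice[OF this] obtain k where k': "\<forall>V\<in>K. k V \<in> carrier L \<and> V = h (k V)" ..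
    have k: "k V \<in> carrier L" "h (k V) = V" if "V \<in> K" for V
      using bspec[OF k' that] by simp_all
    have "openin X (\<Union>V\<in>K. f (k V))"
      by (rule openin_clauses(3)) (auto intro!: op k(1))
    then obtain z where z: "z \<in> carrier L" "f z = (\<Union>V\<in>K. f (k V))"
      using f_surj[of "\<Union>V\<in>K. f (k V)"] by auto
    have *: "P \<in> \<Union>K \<longleftrightarrow> P \<in> h z" for P
    proof (cases "P \<in> g ` topspace X")
      case True
      then obtain p where p: "p \<in> topspace X" "P = g p" by blast
      have "P \<in> h z \<longleftrightarrow> (\<exists>V\<in>K. p \<in> f (k V))"
        using h_iff[OF z(1) p(1)] z(2) p(2) by auto
      also have "\<dots> \<longleftrightarrow> (\<exists>V\<in>K. P \<in> h (k V))"
      proof (intro bex_cong refl)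
        fix V assume "V \<in> K"
        then show "p \<in> f (k V) \<longleftrightarrow> P \<in> h (k V)"
          using h_iff[OF k(1) p(1)] p(2) by simp
      qed
      also have "\<dots> \<longleftrightarrow> (\<exists>V\<in>K. P \<in> V)"
        using k by (intro bex_cong) auto
      also have "\<dots> \<longleftrightarrow> P \<in> \<Union>K"
        by auto
      finally show ?thesis ..
    next
      case False
      have "P \<notin> V" if "V \<in> K" for V
        using k(2)[OF that] h_sub[of "k V"] False by blast
      moreover have "P \<notin> h z"
        using h_sub[of z] False by blast
      ultimately show ?thesis by blast
    qed
    show "T (\<Union>K)"
      unfolding T_def using z(1) Set.set_eqI[OF *] by (intro bexI[of _ z])
  qed
  then have open_T: "openin (topology T) = T"
    by simp
  have "bij_betw h (carrier L) (carrier (opens_lattice (topology T)))"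
    unfolding bij_betw_def
  proof
    show "inj_on h (carrier L)"
    proof (rule inj_onI)
      fix x y assume xy: "x \<in> carrier L" "y \<in> carrier L" "h x = h y"
      then have "f x = f y"
        using h_mono[of x y] h_mono[of y x] by simp
      then show "x = y"
        using inj_onD[OF bij_betw_imp_inj_on[OF bij]] xy by simp
    qed
    show "h ` carrier L = carrier (opens_lattice (topology T))"
      unfolding opens_lattice_def open_T by (simp add: T_def image_def)
  qed
  moreover have "order_emb L (opens_lattice (topology T)) h"
    using emb h_mono partial_order.axioms(1)[OF partial_order_opens_lattice[of "topology T"]]
    by (simp add: order_emb_def opens_lattice_def)
  ultimately show ?thesis
    unfolding spatial_def by blast
qed

section \<open>The Scott topology\<close>

definition directed_in :: "('a, 'm) gorder_scheme \<Rightarrow> 'a set \<Rightarrow> bool" where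
  "directed_in L D \<longleftrightarrow>
     D \<subseteq> carrier L \<and> D \<noteq> {} \<and> (\<forall>x\<in>D. \<forall>y\<in>D. \<exists>z\<in>D. x \<sqsubseteq>\<^bsub>L\<^esub> z \<and> y \<sqsubseteq>\<^bsub>L\<^esub> z)"

definition scott_open :: "('a, 'm) gorder_scheme \<Rightarrow> 'a set \<Rightarrow> bool" where
  "scott_open L U \<longleftrightarrow>
     U \<subseteq> carrier L \<and>
     (\<forall>x\<in>U. \<forall>y\<in>carrier L. x \<sqsubseteq>\<^bsub>L\<^esub> y \<longrightarrow> y \<in> U) \<and>
     (\<forall>D. directed_in L D \<and> \<Squnion>\<^bsub>L\<^esub>D \<in> U \<longrightarrow> D \<inter> U \<noteq> {})"

definition Scott :: "('a, 'm) gorder_scheme \<Rightarrow> 'a topology" where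
  "Scott L = topology (scott_open L)"

lemma istopology_scott_open: "istopology (scott_open L)"
  unfolding istopology_def
proof (intro conjI allI impI)
  fix U V assume U: "scott_open L U" and V: "scott_open L V"
  have "D \<inter> (U \<inter> V) \<noteq> {}" if D: "directed_in L D" "\<Squnion>\<^bsub>L\<^esub>D \<in> U \<inter> V" for D
  proof -
    obtain x y where xy: "x \<in> D" "x \<in> U" "y \<in> D" "y \<in> V"
      using U V D unfolding scott_open_def by blast
    then obtain z where z: "z \<in> D" "x \<sqsubseteq>\<^bsub>L\<^esub> z" "y \<sqsubseteq>\<^bsub>L\<^esub> z"
      using D unfolding directed_in_def by meson
    moreover have "z \<in> carrier L"
      using D z by (auto simp: directed_in_def)
    ultimately have "z \<in> U \<inter> V"
      using U V xy unfolding scott_open_def by blast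
    with z show ?thesis by blast
  qed
  then show "scott_open L (U \<inter> V)"
    using U V unfolding scott_open_def by blast
next
  fix K assume K: "\<forall>U\<in>K. scott_open L U"
  have "D \<inter> \<Union>K \<noteq> {}" if D: "directed_in L D" "\<Squnion>\<^bsub>L\<^esub>D \<in> \<Union>K" for D
  proof -
    obtain U where U: "U \<in> K" "\<Squnion>\<^bsub>L\<^esub>D \<in> U"
      using D(2) by blast
    with K D(1) have "D \<inter> U \<noteq> {}"
      by (simp add: scott_open_def)
    with U show ?thesis by blast
  qed
  moreover have "\<Union>K \<subseteq> carrier L"
    using K by (auto simp: scott_open_def)
  moreover have "y \<in> \<Union>K" if xy: "x \<in> \<Union>K" "y \<in> carrier L" "x \<sqsubseteq>\<^bsub>L\<^esub> y" for x y
  proof -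
    obtain U where U: "U \<in> K" "x \<in> U"
      using xy(1) by blast
    with K xy(2,3) have "y \<in> U"
      unfolding scott_open_def by meson
    with U show ?thesis by blast
  qed
  ultimately show "scott_open L (\<Union>K)"
    unfolding scott_open_def by meson
qed

lemma openin_Scott: "openin (Scott L) U \<longleftrightarrow> scott_open L U"
  by (simp add: Scott_def istopology_scott_open)

lemma topspace_Scott: "topspace (Scott L) = carrier L"
proof -
  have "scott_open L (carrier L)"
    by (auto simp: scott_open_def directed_in_def)
  then show ?thesis
    unfolding topspace_def openin_Scott by (auto simp: scott_open_def)
qed

section \<open>Sobriety\<close>

definition irreducible_closedin :: "'a topology \<Rightarrow> 'a set \<Rightarrow> bool" where
  "irreducible_closedin X C \<longleftrightarrow>
     closedin X C \<and> C \<noteq> {} \<and>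
     (\<forall>A B. closedin X A \<and> closedin X B \<and> C = A \<union> B \<longrightarrow> C = A \<or> C = B)"

definition sober_space :: "'a topology \<Rightarrow> bool" where
  "sober_space X \<longleftrightarrow>
     t0_space X \<and>
     (\<forall>C. irreducible_closedin X C \<longrightarrow> (\<exists>!x. x \<in> topspace X \<and> C = X closure_of {x}))"

section \<open>The non-sobriety spectra\<close>

text \<open>
  Cardinals are represented, as usual in HOL, by cardinal orders \<open>\<kappa> :: 'k rel\<close> with
  \<^term>\<open>Card_order \<kappa>\<close>, and compared across types by \<open>\<le>o\<close> and \<open>=o\<close>.  The class of all cardinals thus
  becomes a family of sets, indexed by the type \<open>'k\<close> and closed under \<open>=o\<close>.  A frame of
  cardinality \<open>\<kappa>\<close> has an isomorphic copy whose carrier is a set of elements of type \<open>'k\<close>, so it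
  suffices to consider these.
\<close>

definition NSpec_fr :: "'k rel set" where
  "NSpec_fr = {\<kappa>. Cinfinite \<kappa> \<and>
     (\<exists>L :: 'k gorder. frame L \<and> |carrier L| =o \<kappa> \<and> \<not> sober_space (Scott L))}"

definition NSpec_sp :: "'k rel set" where
  "NSpec_sp = {\<kappa>. Cinfinite \<kappa> \<and>
     (\<exists>L :: 'k gorder. frame L \<and> spatial L \<and> |carrier L| =o \<kappa> \<and> \<not> sober_space (Scott L))}"

definition min_card :: "'k rel set \<Rightarrow> 'k rel" where
  "min_card \<C> = (SOME \<kappa>. \<kappa> \<in> \<C> \<and> (\<forall>\<mu>\<in>\<C>. \<kappa> \<le>o \<mu>))"

lemma min_card:
  assumes "\<C> \<noteq> {}" "\<forall>\<kappa>\<in>\<C>. Card_order \<kappa>"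
  shows "min_card \<C> \<in> \<C>" "\<mu> \<in> \<C> \<Longrightarrow> min_card \<C> \<le>o \<mu>"
proof -
  have "\<exists>\<kappa>. \<kappa> \<in> \<C> \<and> (\<forall>\<mu>\<in>\<C>. \<kappa> \<le>o \<mu>)"
    using exists_minim_Card_order[OF assms] by blast
  from someI_ex[OF this] show "min_card \<C> \<in> \<C>" "\<mu> \<in> \<C> \<Longrightarrow> min_card \<C> \<le>o \<mu>"
    unfolding min_card_def by blast+
qed

text \<open>
  The two minima are meaningful at those types \<open>'k\<close> that are large enough to carry a member of the
  respective class.  Since every cardinal below a cardinal on \<open>'k\<close> is again realised on \<open>'k\<close>, they
  are then minimal among the members on all types, and do not depend on \<open>'k\<close> up to \<open>=o\<close>.
\<close>

definition s_fr :: "'k rel" where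
  "s_fr = min_card NSpec_fr"

definition s_sp :: "'k rel" where
  "s_sp = min_card NSpec_sp"

end

theory Submission
  imports Defs
begin

text \<open>
  Let \<open>L\<close> be a frame with non-sober Scott topology and put a chain \<open>C\<close> on top of it in which every
  nonempty subset has a greatest element (a reversed well-order).  The result is again a frame,
  spatial if \<open>L\<close> is.  A Scott-closed set of a complete lattice is a counterexample to sobriety iff it is
  irreducible and not a principal down-set, and \<open>L\<close> is a Scott-closed part of the extension
  on which both notions are unchanged.  So the extension is non-sober, and a suitable length of \<open>C\<close>
  gives it any prescribed cardinality \<open>\<kappa> \<ge> |L|\<close>.
\<close>

section \<open>Frames, spatiality and sobriety in terms of the order\<close>

text \<open>The infimum of \<open>A\<close> is found as the supremum of the set of its lower
  bounds.\<close>

lemma (in partial_order) complete_latticeI_sup: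
  assumes sup: "\<And>A. A \<subseteq> carrier L \<Longrightarrow> \<exists>s. least L s (Upper L A)"
  shows "complete_lattice L"
proof
  fix A assume A: "A \<subseteq> carrier L"
  obtain s where s: "least L s (Upper L (Lower L A))"
    using sup[of "Lower L A"] by auto
  have "greatest L s (Lower L A)"
  proof (rule greatest_LowerI)
    show "s \<sqsubseteq> x" if "x \<in> A" for x
      using that A by (intro least_le[OF s]) (auto simp: Upper_def Lower_def)
    show "y \<sqsubseteq> s" if "y \<in> Lower L A" for y
      using least_Upper_above[OF s that] by simp
  qed (use A s in auto)
  then show "\<exists>i. greatest L i (Lower L A)" ..
qed (rule sup)

context complete_lattice
begin

lemma sup_eqI:
  assumes "A \<subseteq> carrier L" "least L s (Upper L A)"
  shows "\<Squnion>A = s"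
  using least_unique[OF sup_lub] assms by simp

lemma sup_eq_greatest:
  assumes "A \<subseteq> carrier L" "m \<in> A" "\<And>s. s \<in> A \<Longrightarrow> s \<sqsubseteq> m"
  shows "\<Squnion>A = m"
  using assms by (intro sup_eqI least_UpperI) (auto simp: Upper_def)

lemma meet_eq_left:
  assumes "x \<in> carrier L" "y \<in> carrier L" "x \<sqsubseteq> y"
  shows "x \<sqinter> y = x"
  using le_iff_join assms by simp

lemma meet_eq_right:
  assumes "x \<in> carrier L" "y \<in> carrier L" "y \<sqsubseteq> x"
  shows "x \<sqinter> y = y"
  using le_iff_join[of y x] assms by (simp add: meet_comm)

text \<open>One inequality of the distributive law holds in every complete lattice. The other is put
  as a bound by any \<open>u\<close> above all the meets, without the supremum on its right-hand
  side.\<close>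

lemma frameI:
  assumes le: "\<And>a S u. \<lbrakk>a \<in> carrier L; S \<subseteq> carrier L; u \<in> carrier L; \<And>s. s \<in> S \<Longrightarrow> a \<sqinter> s \<sqsubseteq> u\<rbrakk>
    \<Longrightarrow> a \<sqinter> \<Squnion>S \<sqsubseteq> u"
  shows "frame L"
proof unfold_locales
  fix a S assume a: "a \<in> carrier L" and S: "S \<subseteq> carrier L"
  have im: "(\<lambda>s. a \<sqinter> s) ` S \<subseteq> carrier L"
    using a S by auto
  show "a \<sqinter> \<Squnion>S = \<Squnion>((\<lambda>s. a \<sqinter> s) ` S)"
  proof (rule le_antisym)
    show "a \<sqinter> \<Squnion>S \<sqsubseteq> \<Squnion>((\<lambda>s. a \<sqinter> s) ` S)"
      using im by (intro le a S sup_closed sup_upper) auto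
    show "\<Squnion>((\<lambda>s. a \<sqinter> s) ` S) \<sqsubseteq> a \<sqinter> \<Squnion>S"
    proof (rule sup_least[OF im])
      fix x assume "x \<in> (\<lambda>s. a \<sqinter> s) ` S"
      then obtain s where s: "s \<in> S" "x = a \<sqinter> s" by auto
      have sL: "s \<in> carrier L" using s S by auto
      have "a \<sqinter> s \<sqsubseteq> \<Squnion>S"
        using le_trans[OF meet_right[OF a sL] sup_upper[OF S s(1)]] a sL S by simp
      then show "x \<sqsubseteq> a \<sqinter> \<Squnion>S"
        using a sL S s(2) by (simp add: meet_le meet_left)
    qed (use a S in auto)
  qed (use a S im in auto)
qed

text \<open>The sets \<open>g x\<close> themselves form a topology: meets give closure under
  intersection, suprema give closure under union. The points may have any type, since
  \<open>spatialI\<close> passes to the type used in \<open>spatial\<close>.\<close>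

lemma spatial_if_embedding:
  fixes g :: "'a \<Rightarrow> 'p set"
  assumes le: "\<And>x y. \<lbrakk>x \<in> carrier L; y \<in> carrier L\<rbrakk> \<Longrightarrow> g x \<subseteq> g y \<longleftrightarrow> x \<sqsubseteq> y"
    and meet: "\<And>x y. \<lbrakk>x \<in> carrier L; y \<in> carrier L\<rbrakk> \<Longrightarrow> g (x \<sqinter> y) = g x \<inter> g y"
    and sup: "\<And>S. S \<subseteq> carrier L \<Longrightarrow> g (\<Squnion>S) = \<Union> (g ` S)"
  shows "spatial L"
proof -
  define T where "T = (\<lambda>U. U \<in> g ` carrier L)"
  have "istopology T"
    unfolding istopology_def
  proof (intro conjI allI impI)
    fix U V assume "T U" "T V"
    then obtain x y where xy: "x \<in> carrier L" "y \<in> carrier L" "U = g x" "V = g y"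
      by (auto simp: T_def)
    then show "T (U \<inter> V)"
      unfolding T_def by (intro image_eqI[of _ _ "x \<sqinter> y"]) (auto simp: meet)
  next
    fix K assume "\<forall>U\<in>K. T U"
    then have "K \<subseteq> g ` carrier L"
      by (auto simp: T_def)
    then obtain S where "S \<subseteq> carrier L" "K = g ` S"
      by (auto simp: subset_image_iff)
    then show "T (\<Union>K)"
      unfolding T_def by (intro image_eqI[of _ _ "\<Squnion>S"]) (auto simp: sup)
  qed
  then have open_T: "openin (topology T) = T"
    by simp
  have inj: "inj_on g (carrier L)"
  proof (rule inj_onI)
    fix x y assume "x \<in> carrier L" "y \<in> carrier L" "g x = g y"
    then show "x = y"
      using le[of x y] le[of y x] by (intro le_antisym) auto
  qed
  show ?thesis
  proof (rule spatialI)
    show "bij_betw g (carrier L) (carrier (opens_lattice (topology T)))"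
      unfolding bij_betw_def opens_lattice_def open_T using inj by (simp add: T_def)
    show "order_emb L (opens_lattice (topology T)) g"
      using partial_order.axioms(1)[OF partial_order_opens_lattice[of "topology T"]]
        weak_partial_order_axioms le
      by (simp add: order_emb_def opens_lattice_def)
  qed
qed

text \<open>Converse to \<open>spatial_if_embedding\<close>. Binary intersections and unions of open
  sets are open, hence of the form \<open>f z\<close>; comparing \<open>z\<close> in
  \<open>L\<close> identifies it with the meet or the supremum.\<close>

lemma spatial_obtains_embedding:
  assumes "spatial L"
  obtains f :: "'a \<Rightarrow> 'a set set" where
    "\<And>x y. \<lbrakk>x \<in> carrier L; y \<in> carrier L\<rbrakk> \<Longrightarrow> f x \<subseteq> f y \<longleftrightarrow> x \<sqsubseteq> y"
    "\<And>x y. \<lbrakk>x \<in> carrier L; y \<in> carrier L\<rbrakk> \<Longrightarrow> f (x \<sqinter> y) = f x \<inter> f y"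
    "\<And>S. S \<subseteq> carrier L \<Longrightarrow> f (\<Squnion>S) = \<Union> (f ` S)"
proof -
  from assms obtain X :: "'a set topology" and f where
    bij: "bij_betw f (carrier L) (carrier (opens_lattice X))"
    and emb: "order_emb L (opens_lattice X) f"
    unfolding spatial_def by blast
  have im: "f ` carrier L = {U. openin X U}"
    using bij by (simp add: bij_betw_def opens_lattice_def)
  have le: "f x \<subseteq> f y \<longleftrightarrow> x \<sqsubseteq> y" if "x \<in> carrier L" "y \<in> carrier L" for x y
    using emb that by (simp add: order_emb_def opens_lattice_def)
  have op: "openin X (f x)" if "x \<in> carrier L" for x
    using im that by blast
  have surj: "\<exists>x\<in>carrier L. f x = U" if "openin X U" for U
    using im that by (metis imageE mem_Collect_eq)
  have "f (x \<sqinter> y) = f x \<inter> f y" if xy: "x \<in> carrier L" "y \<in> carrier L" for x y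
  proof
    show "f (x \<sqinter> y) \<subseteq> f x \<inter> f y"
      using xy by (simp add: le meet_left meet_right)
    obtain z where z: "z \<in> carrier L" "f z = f x \<inter> f y"
      using surj[of "f x \<inter> f y"] op xy by auto
    then have "z \<sqsubseteq> x" "z \<sqsubseteq> y"
      using le[of z] xy by auto
    then show "f x \<inter> f y \<subseteq> f (x \<sqinter> y)"
      using z xy le[of z "x \<sqinter> y"] by (simp add: meet_le)
  qed
  moreover have "f (\<Squnion>S) = \<Union> (f ` S)" if S: "S \<subseteq> carrier L" for S
  proof
    have "f x \<subseteq> f (\<Squnion>S)" if "x \<in> S" for x
      using that S le[of x "\<Squnion>S"] sup_upper by auto
    then show "\<Union> (f ` S) \<subseteq> f (\<Squnion>S)"
      by blast
    have "openin X (\<Union> (f ` S))"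
      using op S by (intro openin_clauses(3)) auto
    then obtain z where z: "z \<in> carrier L" "f z = \<Union> (f ` S)"
      using surj by blast
    then have "x \<sqsubseteq> z" if "x \<in> S" for x
      using le[of x z] that S by blast
    then show "f (\<Squnion>S) \<subseteq> \<Union> (f ` S)"
      using z S le[of "\<Squnion>S" z] by (simp add: sup_least)
  qed
  ultimately show thesis
    using that le by blast
qed

end

text \<open>Complement form of \<open>scott_open\<close>. In an arbitrary \<open>L\<close> a
  supremum may fall outside the carrier, which is why the last clause asks for membership.\<close>

lemma closedin_Scott:
  "closedin (Scott L) A \<longleftrightarrow>
     A \<subseteq> carrier L \<and>
     (\<forall>x\<in>carrier L. \<forall>y\<in>A. x \<sqsubseteq>\<^bsub>L\<^esub> y \<longrightarrow> x \<in> A) \<and>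
     (\<forall>D. directed_in L D \<and> D \<subseteq> A \<and> \<Squnion>\<^bsub>L\<^esub>D \<in> carrier L \<longrightarrow> \<Squnion>\<^bsub>L\<^esub>D \<in> A)"
proof (cases "A \<subseteq> carrier L")
  case True
  have "(\<forall>x\<in>carrier L - A. \<forall>y\<in>carrier L. x \<sqsubseteq>\<^bsub>L\<^esub> y \<longrightarrow> y \<in> carrier L - A) \<longleftrightarrow>
      (\<forall>x\<in>carrier L. \<forall>y\<in>A. x \<sqsubseteq>\<^bsub>L\<^esub> y \<longrightarrow> x \<in> A)"
    using True by auto
  moreover have "(directed_in L D \<and> \<Squnion>\<^bsub>L\<^esub>D \<in> carrier L - A \<longrightarrow> D \<inter> (carrier L - A) \<noteq> {}) \<longleftrightarrow>
      (directed_in L D \<and> D \<subseteq> A \<and> \<Squnion>\<^bsub>L\<^esub>D \<in> carrier L \<longrightarrow> \<Squnion>\<^bsub>L\<^esub>D \<in> A)" for D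
    by (auto simp: directed_in_def)
  ultimately show ?thesis
    unfolding closedin_def topspace_Scott openin_Scott scott_open_def using True by simp
qed (simp add: closedin_def topspace_Scott)

context complete_lattice
begin

text \<open>The principal down-set is already Scott closed, as \<open>x\<close> bounds the supremum
  of each of its directed subsets.\<close>

lemma Scott_closure_of_singleton:
  assumes x: "x \<in> carrier L"
  shows "Scott L closure_of {x} = {y \<in> carrier L. y \<sqsubseteq> x}"
proof (rule closure_of_unique)
  have "\<Squnion>D \<sqsubseteq> x" if "directed_in L D" "D \<subseteq> {y \<in> carrier L. y \<sqsubseteq> x}" for D
    using that x by (intro sup_least) auto
  then show "closedin (Scott L) {y \<in> carrier L. y \<sqsubseteq> x}"
    unfolding closedin_Scott using x by (auto intro: le_trans)
  show "{y \<in> carrier L. y \<sqsubseteq> x} \<subseteq> T" if "{x} \<subseteq> T" "closedin (Scott L) T" for T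
    using that unfolding closedin_Scott by auto
qed (use x in auto)

text \<open>By antisymmetry a principal down-set determines its generator. This gives both the T0
  property and the uniqueness of generic points, so that only their existence remains of
  sobriety.\<close>

lemma sober_Scott_iff:
  "sober_space (Scott L) \<longleftrightarrow>
     (\<forall>A. irreducible_closedin (Scott L) A \<longrightarrow> (\<exists>x\<in>carrier L. A = {y \<in> carrier L. y \<sqsubseteq> x}))"
proof -
  have inj: "x = y" if "x \<in> carrier L" "y \<in> carrier L"
    "{z \<in> carrier L. z \<sqsubseteq> x} = {z \<in> carrier L. z \<sqsubseteq> y}" for x y
    using that by (intro le_antisym) auto
  have "t0_space (Scott L)"
    unfolding t0_space_closure_of_sing topspace_Scott
    by (intro ballI impI inj) (simp_all add: Scott_closure_of_singleton)
  moreover have "(\<exists>!x. x \<in> carrier L \<and> A = Scott L closure_of {x}) \<longleftrightarrow>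
      (\<exists>x\<in>carrier L. A = {y \<in> carrier L. y \<sqsubseteq> x})" for A
  proof -
    have "(\<exists>!x. x \<in> carrier L \<and> A = Scott L closure_of {x}) \<longleftrightarrow>
        (\<exists>!x. x \<in> carrier L \<and> A = {y \<in> carrier L. y \<sqsubseteq> x})"
      using Scott_closure_of_singleton by (simp cong: conj_cong)
    also have "\<dots> \<longleftrightarrow> (\<exists>x\<in>carrier L. A = {y \<in> carrier L. y \<sqsubseteq> x})"
      unfolding Bex_def by (intro iffI ex_ex1I) (blast intro: inj)+
    finally show ?thesis .
  qed
  ultimately show ?thesis
    unfolding sober_space_def topspace_Scott by simp
qed

end

section \<open>Extending a frame by a chain\<close>

text \<open>\<open>e\<close> places a copy of \<open>L\<close> at the bottom of \<open>M\<close>;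
  the rest of \<open>M\<close> is the chain. Applied to pairs, \<open>chain_greatest\<close> makes
  the chain total; in general it makes every supremum of a nonempty part of the chain attained. The
  explicit \<open>e\<close> lets \<open>M\<close> live on another type than
  \<open>L\<close>.\<close>

locale chain_extension = L: frame L + M: partial_order M
  for L :: "'a gorder" (structure) and M :: "'b gorder" +
  fixes e :: "'a \<Rightarrow> 'b"
  assumes e_closed: "x \<in> carrier L \<Longrightarrow> e x \<in> carrier M"
    and e_le: "\<lbrakk>x \<in> carrier L; y \<in> carrier L\<rbrakk> \<Longrightarrow> e x \<sqsubseteq>\<^bsub>M\<^esub> e y \<longleftrightarrow> x \<sqsubseteq> y"
    and chain_above: "\<lbrakk>x \<in> carrier L; c \<in> carrier M - e ` carrier L\<rbrakk> \<Longrightarrow> e x \<sqsubseteq>\<^bsub>M\<^esub> c"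
    and chain_greatest:
      "\<lbrakk>S \<subseteq> carrier M - e ` carrier L; S \<noteq> {}\<rbrakk> \<Longrightarrow> \<exists>m\<in>S. \<forall>s\<in>S. s \<sqsubseteq>\<^bsub>M\<^esub> m"
begin

section \<open>Order structure of the extension\<close>

lemma inj_e: "inj_on e (carrier L)"
proof (rule inj_onI)
  fix x y assume "x \<in> carrier L" "y \<in> carrier L" "e x = e y"
  then show "x = y"
    using e_le[of x y] e_le[of y x] e_closed[of x] by (intro L.le_antisym) auto
qed

text \<open>The copy of \<open>L\<close> is a down-set: a chain element below \<open>e x\<close>
  would also lie above it, hence equal it.\<close>

lemma below_e:
  assumes "x \<in> carrier L" "y \<in> carrier M" "y \<sqsubseteq>\<^bsub>M\<^esub> e x"
  obtains z where "z \<in> carrier L" "y = e z" "z \<sqsubseteq> x"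
proof -
  have "y \<in> e ` carrier L"
  proof (rule ccontr)
    assume y: "y \<notin> e ` carrier L"
    then have "y = e x"
      using assms chain_above e_closed by (intro M.le_antisym) auto
    with y assms(1) show False by blast
  qed
  with assms e_le that show thesis by auto
qed

lemma comparable:
  assumes "x \<in> carrier M" "y \<in> carrier M" "x \<notin> e ` carrier L"
  shows "x \<sqsubseteq>\<^bsub>M\<^esub> y \<or> y \<sqsubseteq>\<^bsub>M\<^esub> x"
proof (cases "y \<in> e ` carrier L")
  case True
  then show ?thesis using chain_above assms by auto
next
  case False
  \<comment> \<open>The greatest element of the pair decides how two chain elements compare.\<close>
  then show ?thesis using chain_greatest[of "{x, y}"] assms by auto
qed

text \<open>The dichotomy behind the later arguments: a supremum is either computed in
  \<open>L\<close> or attained. If \<open>S\<close> meets the chain, the greatest element of that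
  part of \<open>S\<close> also bounds the part in the copy of \<open>L\<close>, which lies below
  the whole chain.\<close>

lemma subset_cases:
  assumes "S \<subseteq> carrier M"
  obtains T where "T \<subseteq> carrier L" "S = e ` T"
  | m where "m \<in> S" "\<And>s. s \<in> S \<Longrightarrow> s \<sqsubseteq>\<^bsub>M\<^esub> m"
proof (cases "S \<subseteq> e ` carrier L")
  case True
  then show thesis using that(1) by (auto simp: subset_image_iff)
next
  case False
  then have "S - e ` carrier L \<noteq> {}" "S - e ` carrier L \<subseteq> carrier M - e ` carrier L"
    using assms by auto
  then obtain m where m: "m \<in> S - e ` carrier L" "\<forall>s\<in>S - e ` carrier L. s \<sqsubseteq>\<^bsub>M\<^esub> m"
    using chain_greatest[of "S - e ` carrier L"] by metis
  have "s \<sqsubseteq>\<^bsub>M\<^esub> m" if "s \<in> S" for s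
  proof (cases "s \<in> e ` carrier L")
    case True
    then obtain x where "x \<in> carrier L" "s = e x" by auto
    then show ?thesis using chain_above[of x m] m(1) assms by auto
  next
    case False
    then show ?thesis using m(2) that by blast
  qed
  with m(1) show thesis by (intro that(2)[of m]) auto
qed

section \<open>Suprema, meets and the frame law\<close>

lemma least_Upper_e:
  assumes T: "T \<subseteq> carrier L"
  shows "least M (e (\<Squnion>T)) (Upper M (e ` T))"
proof (rule least_UpperI)
  show "x \<sqsubseteq>\<^bsub>M\<^esub> e (\<Squnion>T)" if "x \<in> e ` T" for x
    using that T by (auto simp: e_le L.sup_upper subset_iff)
next
  fix y assume y: "y \<in> Upper M (e ` T)"
  then have yM: "y \<in> carrier M" by (simp add: Upper_def)
  show "e (\<Squnion>T) \<sqsubseteq>\<^bsub>M\<^esub> y"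
  \<comment> \<open>An upper bound in the copy is compared inside \<open>L\<close>; one in the chain
    lies above the whole copy anyway.\<close>
  proof (cases "y \<in> e ` carrier L")
    case True
    then obtain z where z: "z \<in> carrier L" "y = e z" by auto
    have "t \<sqsubseteq> z" if t: "t \<in> T" for t
    proof -
      have tL: "t \<in> carrier L" using t T by auto
      then have "e t \<sqsubseteq>\<^bsub>M\<^esub> e z"
        using y z t e_closed by (auto simp: Upper_def)
      then show ?thesis using e_le tL z by simp
    qed
    then show ?thesis using z T by (simp add: e_le L.sup_least)
  next
    case False
    then show ?thesis using chain_above yM T by simp
  qed
qed (use T e_closed in auto)

sublocale M: complete_lattice M
proof (rule M.complete_latticeI_sup)
  fix A assume A: "A \<subseteq> carrier M"
  then show "\<exists>s. least M s (Upper M A)"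
  proof (cases rule: subset_cases)
    case (1 T)
    then show ?thesis using least_Upper_e by blast
  next
    case (2 m)
    have "least M m (Upper M A)"
      using A 2 by (intro least_UpperI) (auto simp: Upper_def)
    then show ?thesis ..
  qed
qed

lemma sup_e:
  assumes "T \<subseteq> carrier L"
  shows "\<Squnion>\<^bsub>M\<^esub>(e ` T) = e (\<Squnion>T)"
  using assms e_closed by (intro M.sup_eqI least_Upper_e) auto

lemma meet_e:
  assumes xy: "x \<in> carrier L" "y \<in> carrier L"
  shows "e x \<sqinter>\<^bsub>M\<^esub> e y = e (x \<sqinter> y)"
proof (rule M.le_antisym)
  have cl: "e x \<in> carrier M" "e y \<in> carrier M" "e (x \<sqinter> y) \<in> carrier M"
    using xy e_closed by auto
  then show "e x \<sqinter>\<^bsub>M\<^esub> e y \<in> carrier M" "e (x \<sqinter> y) \<in> carrier M"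
    by auto
  show "e (x \<sqinter> y) \<sqsubseteq>\<^bsub>M\<^esub> e x \<sqinter>\<^bsub>M\<^esub> e y"
    using xy cl by (intro M.meet_le) (auto simp: e_le L.meet_left L.meet_right)
  \<comment> \<open>The meet lies below \<open>e x\<close>, hence in the copy of \<open>L\<close>,
    where \<open>z\<close> is a common lower bound of \<open>x\<close> and \<open>y\<close>.\<close>
  obtain z where z: "z \<in> carrier L" "e x \<sqinter>\<^bsub>M\<^esub> e y = e z" "z \<sqsubseteq> x"
    using below_e[OF xy(1) _ M.meet_left[OF cl(1,2)]] cl by auto
  moreover have "z \<sqsubseteq> y"
    using M.meet_right[OF cl(1,2)] z xy e_le by simp
  ultimately show "e x \<sqinter>\<^bsub>M\<^esub> e y \<sqsubseteq>\<^bsub>M\<^esub> e (x \<sqinter> y)"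
    using xy by (simp add: e_le L.meet_le)
qed

text \<open>If \<open>S\<close> has a greatest element, that element is its supremum and the claim
  is one of the assumed bounds. Otherwise \<open>S\<close> comes from \<open>L\<close>: for
  \<open>a\<close> in the copy the law of \<open>L\<close> applies, and for \<open>a\<close> in the
  chain meeting with \<open>a\<close> changes nothing.\<close>

lemma frame_extension: "frame M"
proof (rule M.frameI)
  fix a S u
  assume a: "a \<in> carrier M" and S: "S \<subseteq> carrier M" and u: "u \<in> carrier M"
    and le: "\<And>s. s \<in> S \<Longrightarrow> a \<sqinter>\<^bsub>M\<^esub> s \<sqsubseteq>\<^bsub>M\<^esub> u"
  from S show "a \<sqinter>\<^bsub>M\<^esub> \<Squnion>\<^bsub>M\<^esub>S \<sqsubseteq>\<^bsub>M\<^esub> u"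
  proof (cases rule: subset_cases)
    case (2 m)
    then show ?thesis using M.sup_eq_greatest[OF S, of m] le by simp
  next
    case T: (1 T)
    show ?thesis
    proof (cases "a \<in> e ` carrier L")
      case True
      then obtain x where x: "x \<in> carrier L" "a = e x" by auto
      have "a \<sqinter>\<^bsub>M\<^esub> \<Squnion>\<^bsub>M\<^esub>S = e (\<Squnion>((\<lambda>t. x \<sqinter> t) ` T))"
        using x T by (simp add: sup_e meet_e L.inf_Sup_distrib)
      also have "\<dots> = \<Squnion>\<^bsub>M\<^esub>((\<lambda>s. a \<sqinter>\<^bsub>M\<^esub> s) ` S)"
      proof -
        have "e ` (\<lambda>t. x \<sqinter> t) ` T = (\<lambda>s. a \<sqinter>\<^bsub>M\<^esub> s) ` S"
          unfolding T(2) x(2) image_image using x T(1) by (intro image_cong) (auto simp: meet_e)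
        moreover have "(\<lambda>t. x \<sqinter> t) ` T \<subseteq> carrier L"
          using x T(1) by auto
        ultimately show ?thesis using sup_e by metis
      qed
      also have "\<dots> \<sqsubseteq>\<^bsub>M\<^esub> u"
        using a S u le by (intro M.sup_least) auto
      finally show ?thesis .
    next
      case False
      have le_a: "y \<sqsubseteq>\<^bsub>M\<^esub> a" if "y \<in> e ` carrier L" for y
        using that chain_above False a by auto
      have "a \<sqinter>\<^bsub>M\<^esub> s = s" if "s \<in> S" for s
        using that T a S by (intro M.meet_eq_right le_a) auto
      then have "s \<sqsubseteq>\<^bsub>M\<^esub> u" if "s \<in> S" for s
        using le that by metis
      then have "\<Squnion>\<^bsub>M\<^esub>S \<sqsubseteq>\<^bsub>M\<^esub> u"
        using S u by (intro M.sup_least)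
      moreover have "a \<sqinter>\<^bsub>M\<^esub> \<Squnion>\<^bsub>M\<^esub>S = \<Squnion>\<^bsub>M\<^esub>S"
        using T a S by (intro M.meet_eq_right le_a) (auto simp: sup_e e_closed)
      ultimately show ?thesis by simp
    qed
  qed
qed

section \<open>Spatiality of the extension\<close>

lemma spatial_extension:
  assumes "spatial L"
  shows "spatial M"
proof -
  from assms obtain f :: "'a \<Rightarrow> 'a set set" where
    f_le: "\<And>x y. \<lbrakk>x \<in> carrier L; y \<in> carrier L\<rbrakk> \<Longrightarrow> f x \<subseteq> f y \<longleftrightarrow> x \<sqsubseteq> y"
    and f_meet: "\<And>x y. \<lbrakk>x \<in> carrier L; y \<in> carrier L\<rbrakk> \<Longrightarrow> f (x \<sqinter> y) = f x \<inter> f y"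
    and f_sup: "\<And>S. S \<subseteq> carrier L \<Longrightarrow> f (\<Squnion>S) = \<Union> (f ` S)"
    using L.spatial_obtains_embedding by blast
  \<comment> \<open>The space of \<open>L\<close> gets a new point \<open>Inr d\<close> for each
    chain element \<open>d\<close>. The open set of a chain element consists of the full
    \<open>range Inl\<close>, so that it includes all open sets coming from \<open>L\<close>, and of
    the new points up to that element.\<close>
  define g :: "'b \<Rightarrow> ('a set + 'b) set" where
    "g y = (if y \<in> e ` carrier L then Inl ` f (inv_into (carrier L) e y)
            else range Inl \<union> Inr ` {d \<in> carrier M - e ` carrier L. d \<sqsubseteq>\<^bsub>M\<^esub> y})" for y
  have g_e: "g (e x) = Inl ` f x" if "x \<in> carrier L" for x
    using that inj_e by (simp add: g_def)
  have g_chain: "g c = range Inl \<union> Inr ` {d \<in> carrier M - e ` carrier L. d \<sqsubseteq>\<^bsub>M\<^esub> c}"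
    if "c \<notin> e ` carrier L" for c
    using that by (simp add: g_def)
  have g_le: "g x \<subseteq> g y \<longleftrightarrow> x \<sqsubseteq>\<^bsub>M\<^esub> y" if xy: "x \<in> carrier M" "y \<in> carrier M" for x y
  proof (cases "x \<in> e ` carrier L")
    case x: True
    then obtain x' where x': "x' \<in> carrier L" "x = e x'" by auto
    show ?thesis
    proof (cases "y \<in> e ` carrier L")
      case True
      then obtain y' where "y' \<in> carrier L" "y = e y'" by auto
      with x' show ?thesis by (simp add: g_e e_le f_le inj_image_subset_iff)
    next
      case False
      then show ?thesis using x' xy chain_above[of x' y] by (auto simp: g_e g_chain)
    qed
  next
    case x: False
    \<comment> \<open>This point is in no open set coming from \<open>L\<close>, and in that of a
      chain element only if \<open>x\<close> is below it. It therefore witnesses each required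
      non-inclusion.\<close>
    then have "Inr x \<in> g x"
      using xy by (auto simp: g_chain)
    show ?thesis
    proof (cases "y \<in> e ` carrier L")
      case True
      then obtain y' where y': "y' \<in> carrier L" "y = e y'" by auto
      then have "\<not> x \<sqsubseteq>\<^bsub>M\<^esub> y"
        using below_e[OF y'(1) xy(1)] x by blast
      with \<open>Inr x \<in> g x\<close> y' show ?thesis by (auto simp: g_e)
    next
      case False
      show ?thesis
      proof
        assume "g x \<subseteq> g y"
        with \<open>Inr x \<in> g x\<close> show "x \<sqsubseteq>\<^bsub>M\<^esub> y"
          using False by (auto simp: g_chain)
      next
        assume "x \<sqsubseteq>\<^bsub>M\<^esub> y"
        then show "g x \<subseteq> g y"
          using x False xy by (auto simp: g_chain intro: M.le_trans)
      qed
    qed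
  qed
  have g_meet: "g (x \<sqinter>\<^bsub>M\<^esub> y) = g x \<inter> g y" if xy: "x \<in> carrier M" "y \<in> carrier M" for x y
  proof (cases "x \<in> e ` carrier L \<and> y \<in> e ` carrier L")
    case True
    then show ?thesis by (auto simp: meet_e g_e f_meet)
  next
    case False
    \<comment> \<open>As soon as one element is in the chain the two are comparable, so the meet is
      one of them and monotonicity of \<open>g\<close> suffices.\<close>
    then consider "x \<sqsubseteq>\<^bsub>M\<^esub> y" | "y \<sqsubseteq>\<^bsub>M\<^esub> x"
      using comparable[of x y] comparable[of y x] xy by blast
    then show ?thesis
    proof cases
      case 1
      then show ?thesis using M.meet_eq_left[of x y] g_le[of x y] xy by auto
    next
      case 2
      then show ?thesis using M.meet_eq_right[of x y] g_le[of y x] xy by auto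
    qed
  qed
  have g_sup: "g (\<Squnion>\<^bsub>M\<^esub>S) = \<Union> (g ` S)" if S: "S \<subseteq> carrier M" for S
    using S
  proof (cases rule: subset_cases)
    case (1 T)
    then have "g (\<Squnion>\<^bsub>M\<^esub>S) = Inl ` \<Union> (f ` T)"
      by (simp add: sup_e g_e f_sup)
    also have "\<dots> = \<Union> (g ` S)"
      using 1 g_e by (auto simp: subset_iff)
    finally show ?thesis .
  next
    case (2 m)
    \<comment> \<open>The supremum is attained at \<open>m\<close>, and the union equals its largest
      member \<open>g m\<close>.\<close>
    then have "g s \<subseteq> g m" if "s \<in> S" for s
      using that g_le[of s m] S by auto
    then have "\<Union> (g ` S) \<subseteq> g m"
      by (rule UN_least)
    moreover have "\<Squnion>\<^bsub>M\<^esub>S = m"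
      using S 2 by (rule M.sup_eq_greatest)
    ultimately show ?thesis
      using 2(1) by (auto intro!: equalityI)
  qed
  from g_le g_meet g_sup show ?thesis
    by (rule M.spatial_if_embedding)
qed

section \<open>Scott-closed sets and non-sobriety\<close>

lemma directed_in_e:
  assumes "D \<subseteq> carrier L"
  shows "directed_in M (e ` D) \<longleftrightarrow> directed_in L D"
proof -
  have "e ` D \<subseteq> carrier M"
    using assms e_closed by auto
  moreover have "(\<exists>z\<in>D. e x \<sqsubseteq>\<^bsub>M\<^esub> e z \<and> e y \<sqsubseteq>\<^bsub>M\<^esub> e z) \<longleftrightarrow> (\<exists>z\<in>D. x \<sqsubseteq> z \<and> y \<sqsubseteq> z)"
    if "x \<in> D" "y \<in> D" for x y
    using that assms by (intro bex_cong) (auto simp: e_le subset_iff)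
  ultimately show ?thesis
    using assms by (simp add: directed_in_def)
qed

text \<open>The copy of \<open>L\<close> is a down-set of \<open>M\<close>, and suprema of its
  subsets are those of \<open>L\<close>; so both closure conditions can be transported along
  \<open>e\<close>.\<close>

lemma closedin_Scott_e:
  assumes A: "A \<subseteq> carrier L"
  shows "closedin (Scott M) (e ` A) \<longleftrightarrow> closedin (Scott L) A"
proof
  assume cl: "closedin (Scott M) (e ` A)"
  show "closedin (Scott L) A"
    unfolding closedin_Scott
  proof (intro conjI ballI allI impI A)
    fix x y assume xy: "x \<in> carrier L" "y \<in> A" "x \<sqsubseteq> y"
    then have "e x \<sqsubseteq>\<^bsub>M\<^esub> e y" "e x \<in> carrier M"
      using A e_le e_closed by auto
    then have "e x \<in> e ` A"
      using cl xy(2) unfolding closedin_Scott by blast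
    then show "x \<in> A"
      using inj_on_image_mem_iff[OF inj_e xy(1) A] by simp
  next
    fix D assume D: "directed_in L D \<and> D \<subseteq> A \<and> \<Squnion>D \<in> carrier L"
    then have DL: "D \<subseteq> carrier L" using A by blast
    then have "e (\<Squnion>D) \<in> e ` A"
      using cl D directed_in_e[OF DL] sup_e[OF DL] e_closed
      unfolding closedin_Scott by (metis image_mono)
    then show "\<Squnion>D \<in> A"
      using inj_on_image_mem_iff[OF inj_e _ A] D by simp
  qed
next
  assume cl: "closedin (Scott L) A"
  show "closedin (Scott M) (e ` A)"
    unfolding closedin_Scott
  proof (intro conjI ballI allI impI)
    show "e ` A \<subseteq> carrier M" using A e_closed by auto
  next
    fix x y assume xy: "x \<in> carrier M" "y \<in> e ` A" "x \<sqsubseteq>\<^bsub>M\<^esub> y"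
    then obtain a where a: "a \<in> A" "y = e a" by auto
    then obtain z where "z \<in> carrier L" "x = e z" "z \<sqsubseteq> a"
      using below_e[of a x] A xy by blast
    then show "x \<in> e ` A"
      using cl a unfolding closedin_Scott by blast
  next
    fix D assume D: "directed_in M D \<and> D \<subseteq> e ` A \<and> \<Squnion>\<^bsub>M\<^esub>D \<in> carrier M"
    then obtain E where E: "E \<subseteq> A" "D = e ` E" by (auto simp: subset_image_iff)
    then have EL: "E \<subseteq> carrier L" using A by blast
    then have "\<Squnion>E \<in> A"
      using cl D E directed_in_e[OF EL] unfolding closedin_Scott by simp
    then show "\<Squnion>\<^bsub>M\<^esub>D \<in> e ` A"
      using E sup_e[OF EL] by simp
  qed
qed

text \<open>The two parts of a decomposition of the image lie inside it, so they pull back along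
  \<open>e\<close> to a decomposition of \<open>A\<close> into closed sets of
  \<open>L\<close>.\<close>

lemma irreducible_closedin_Scott_e:
  assumes irr: "irreducible_closedin (Scott L) A"
  shows "irreducible_closedin (Scott M) (e ` A)"
proof -
  have A: "A \<subseteq> carrier L" "closedin (Scott L) A" "A \<noteq> {}"
    using irr by (auto simp: irreducible_closedin_def closedin_Scott)
  have "e ` A = P \<or> e ` A = Q"
    if PQ: "closedin (Scott M) P" "closedin (Scott M) Q" "e ` A = P \<union> Q" for P Q
  proof -
    obtain P' Q' where P': "P' \<subseteq> A" "P = e ` P'" and Q': "Q' \<subseteq> A" "Q = e ` Q'"
      using PQ(3) by (metis subset_image_iff sup_ge1 sup_ge2)
    have "closedin (Scott L) P'" "closedin (Scott L) Q'"
      using PQ P' Q' A(1) closedin_Scott_e by auto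
    moreover have "A = P' \<union> Q'"
    proof -
      have "e ` A = e ` (P' \<union> Q')" using PQ(3) P' Q' by (simp add: image_Un)
      then show ?thesis
        using inj_on_image_eq_iff[OF inj_e A(1), of "P' \<union> Q'"] A(1) P' Q' by blast
    qed
    ultimately have "A = P' \<or> A = Q'"
      using irr unfolding irreducible_closedin_def by blast
    then show ?thesis using P' Q' by auto
  qed
  then show ?thesis
    using A closedin_Scott_e unfolding irreducible_closedin_def by simp
qed

text \<open>The image of a counterexample \<open>A\<close> is again one. If it were the down-set of
  some \<open>x\<close>, then \<open>x\<close> would belong to it, so \<open>x = e a\<close> with
  \<open>a\<close> in \<open>A\<close>, and \<open>A\<close> would be the down-set of
  \<open>a\<close> in \<open>L\<close>.\<close>

lemma not_sober_extension:
  assumes "\<not> sober_space (Scott L)"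
  shows "\<not> sober_space (Scott M)"
proof -
  from assms obtain A where irr: "irreducible_closedin (Scott L) A"
    and ne: "\<And>x. x \<in> carrier L \<Longrightarrow> A \<noteq> {y \<in> carrier L. y \<sqsubseteq> x}"
    unfolding L.sober_Scott_iff by blast
  have A: "A \<subseteq> carrier L"
    using irr by (auto simp: irreducible_closedin_def closedin_Scott)
  have "e ` A \<noteq> {y \<in> carrier M. y \<sqsubseteq>\<^bsub>M\<^esub> x}" if x: "x \<in> carrier M" for x
  proof
    assume eq: "e ` A = {y \<in> carrier M. y \<sqsubseteq>\<^bsub>M\<^esub> x}"
    then have "x \<in> e ` A" using x by auto
    then obtain a where a: "a \<in> A" "x = e a" by auto
    have "y \<in> A \<longleftrightarrow> y \<sqsubseteq> a" if y: "y \<in> carrier L" for y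
    proof -
      have "y \<in> A \<longleftrightarrow> e y \<in> e ` A"
        using inj_on_image_mem_iff[OF inj_e y A] by simp
      also have "\<dots> \<longleftrightarrow> y \<sqsubseteq> a"
        unfolding eq using y a A e_le e_closed by auto
      finally show ?thesis .
    qed
    then have "y \<in> A \<longleftrightarrow> y \<in> {y \<in> carrier L. y \<sqsubseteq> a}" for y
      using A by (cases "y \<in> carrier L") auto
    then have "A = {y \<in> carrier L. y \<sqsubseteq> a}"
      by (rule Set.set_eqI)
    moreover have "a \<in> carrier L"
      using a(1) A by auto
    ultimately show False
      using ne by simp
  qed
  then have "\<not> (\<exists>x\<in>carrier M. e ` A = {y \<in> carrier M. y \<sqsubseteq>\<^bsub>M\<^esub> x})"
    by simp
  with irreducible_closedin_Scott_e[OF irr] show ?thesis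
    using M.sober_Scott_iff by metis
qed

end

section \<open>Upward closure\<close>

text \<open>\<open>M\<close> is built on the type of \<open>\<kappa>\<close>, since membership of
  \<open>\<kappa>\<close> in a spectrum asks for a frame on that type.\<close>

lemma chain_extension_exists:
  fixes L :: "'a gorder" and \<kappa> :: "'b rel"
  assumes L: "frame L" and \<kappa>: "Card_order \<kappa>" and le: "|carrier L| \<le>o \<kappa>"
  shows "\<exists>(M :: 'b gorder) e. chain_extension L M e \<and> |carrier M| =o \<kappa>"
proof -
  interpret L: frame L by fact
  have "|carrier L| \<le>o |Field \<kappa>|"
    using le card_of_Field_ordIso[OF \<kappa>] ordIso_symmetric ordLeq_ordIso_trans by blast
  then obtain e where inj: "inj_on e (carrier L)" and sub: "e ` carrier L \<subseteq> Field \<kappa>"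
    unfolding card_of_ordLeq[symmetric] by blast
  have wo: "Well_order \<kappa>"
    using \<kappa> by (simp add: card_order_on_def)
  have r_refl: "(x, x) \<in> \<kappa>" if "x \<in> Field \<kappa>" for x
    using wo that by (auto simp: order_on_defs refl_on_def)
  have r_trans: "(x, z) \<in> \<kappa>" if "(x, y) \<in> \<kappa>" "(y, z) \<in> \<kappa>" for x y z
    using wo that by (auto simp: order_on_defs trans_def)
  have r_antisym: "x = y" if "(x, y) \<in> \<kappa>" "(y, x) \<in> \<kappa>" for x y
    using wo that by (auto simp: order_on_defs antisym_def)
  define d where "d = inv_into (carrier L) e"
  have d_e [simp]: "d (e x) = x" if "x \<in> carrier L" for x
    using inj that by (simp add: d_def)
  \<comment> \<open>the chain is what the copy of \<open>L\<close> leaves over of \<open>Field \<kappa>\<close>, so no cardinal arithmetic is needed\<close>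
  define le' where "le' x y =
    (if y \<in> e ` carrier L then x \<in> e ` carrier L \<and> d x \<sqsubseteq>\<^bsub>L\<^esub> d y
     else x \<in> e ` carrier L \<or> (y, x) \<in> \<kappa>)" for x y
  define M :: "'b gorder" where "M = \<lparr>carrier = Field \<kappa>, eq = (=), le = le'\<rparr>"
  have M_simps [simp]: "carrier M = Field \<kappa>" "x \<sqsubseteq>\<^bsub>M\<^esub> y \<longleftrightarrow> le' x y" "x .=\<^bsub>M\<^esub> y \<longleftrightarrow> x = y" for x y
    by (simp_all add: M_def)
  have po: "partial_order M"
  proof unfold_locales
    show "x \<sqsubseteq>\<^bsub>M\<^esub> x" if "x \<in> carrier M" for x
      using that r_refl by (auto simp: le'_def)
    show "x .=\<^bsub>M\<^esub> y" if xy: "x \<sqsubseteq>\<^bsub>M\<^esub> y" "y \<sqsubseteq>\<^bsub>M\<^esub> x" for x y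
    \<comment> \<open>Below an element of the copy there are only elements of the copy. So either
      both elements lie in it and antisymmetry is that of \<open>L\<close>, or neither does and it
      is that of \<open>\<kappa>\<close>.\<close>
    proof (cases "y \<in> e ` carrier L")
      case True
      then obtain a b where "a \<in> carrier L" "x = e a" "b \<in> carrier L" "y = e b"
        using xy(1) by (auto simp: le'_def)
      then show ?thesis
        using xy L.le_antisym[of a b] by (simp add: le'_def)
    next
      case False
      then show ?thesis
        using xy r_antisym[of x y] by (simp add: le'_def split: if_splits)
    qed
    show "x \<sqsubseteq>\<^bsub>M\<^esub> z" if xyz: "x \<sqsubseteq>\<^bsub>M\<^esub> y" "y \<sqsubseteq>\<^bsub>M\<^esub> z" for x y z
    proof (cases "z \<in> e ` carrier L")
      case True
      then have "y \<in> e ` carrier L"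
        using xyz by (simp add: le'_def)
      with True obtain a b c where
        "a \<in> carrier L" "x = e a" "b \<in> carrier L" "y = e b" "c \<in> carrier L" "z = e c"
        using xyz by (auto simp: le'_def)
      then show ?thesis
        using xyz L.le_trans[of a b c] by (simp add: le'_def)
    next
      case False
      then show ?thesis
        using xyz r_trans[of z y x] by (auto simp: le'_def split: if_splits)
    qed
  qed (auto simp: M_def)
  have "\<exists>m\<in>S. \<forall>s\<in>S. s \<sqsubseteq>\<^bsub>M\<^esub> m" if S: "S \<subseteq> Field \<kappa> - e ` carrier L" "S \<noteq> {}" for S
  proof -
    have S': "S \<subseteq> Field \<kappa>" using S by blast
    interpret wo: wo_rel \<kappa>
      using wo by (simp add: wo_rel_def)
    \<comment> \<open>The chain is ordered by the converse of \<open>\<kappa>\<close>, so the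
      \<open>\<kappa>\<close>-least element of \<open>S\<close> is its greatest element in
      \<open>M\<close>.\<close>
    define m where "m = wo.minim S"
    have "m \<in> S" "\<forall>s\<in>S. (m, s) \<in> \<kappa>"
      using wo.minim_in[OF S' S(2)] wo.minim_least[OF S'] by (auto simp: m_def)
    then show ?thesis
      using S by (intro bexI[of _ m]) (auto simp: le'_def)
  qed
  then have "chain_extension L M e"
    using sub
    by (intro chain_extension.intro L po chain_extension_axioms.intro)
      (auto simp: le'_def)
  moreover have "|carrier M| =o \<kappa>"
    using card_of_Field_ordIso[OF \<kappa>] by simp
  ultimately show ?thesis by blast
qed

text \<open>The witness for \<open>\<mu>\<close> is extended to size \<open>\<kappa>\<close>. Stated
  for two independent types, so that membership can be moved between types in either
  direction.\<close>

lemma NSpec_fr_upward_closed: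
  fixes \<mu> :: "'a rel" and \<kappa> :: "'b rel"
  assumes \<mu>: "\<mu> \<in> NSpec_fr" and \<kappa>: "Card_order \<kappa>" and le: "\<mu> \<le>o \<kappa>"
  shows "\<kappa> \<in> NSpec_fr"
proof -
  from \<mu> obtain L :: "'a gorder" where inf: "Cinfinite \<mu>" and L: "frame L" "|carrier L| =o \<mu>"
    "\<not> sober_space (Scott L)"
    unfolding NSpec_fr_def by blast
  obtain M :: "'b gorder" and e where "chain_extension L M e" and card: "|carrier M| =o \<kappa>"
    using chain_extension_exists[OF L(1) \<kappa> ordIso_ordLeq_trans[OF L(2) le]] by blast
  then interpret chain_extension L M e by simp
  show ?thesis
    unfolding NSpec_fr_def
    using cinfinite_mono[OF le] inf \<kappa> frame_extension card not_sober_extension L(3) by blast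
qed

lemma NSpec_sp_upward_closed:
  fixes \<mu> :: "'a rel" and \<kappa> :: "'b rel"
  assumes \<mu>: "\<mu> \<in> NSpec_sp" and \<kappa>: "Card_order \<kappa>" and le: "\<mu> \<le>o \<kappa>"
  shows "\<kappa> \<in> NSpec_sp"
proof -
  from \<mu> obtain L :: "'a gorder" where inf: "Cinfinite \<mu>" and L: "frame L" "|carrier L| =o \<mu>"
    "\<not> sober_space (Scott L)" and sp: "spatial L"
    unfolding NSpec_sp_def by blast
  obtain M :: "'b gorder" and e where "chain_extension L M e" and card: "|carrier M| =o \<kappa>"
    using chain_extension_exists[OF L(1) \<kappa> ordIso_ordLeq_trans[OF L(2) le]] by blast
  then interpret chain_extension L M e by simp
  show ?thesis
    unfolding NSpec_sp_def
    using cinfinite_mono[OF le] inf \<kappa> frame_extension spatial_extension[OF sp] card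
      not_sober_extension L(3) by blast
qed

text \<open>An injection carries \<open>Field \<kappa>\<close> into the type of
  \<open>\<mu>\<close>, and the cardinal of the image is the copy. This makes cardinals on another
  type comparable with a minimum formed on \<open>'s\<close>.\<close>

lemma Card_order_copy:
  fixes \<kappa> :: "'b rel" and \<mu> :: "'s rel"
  assumes \<kappa>: "Card_order \<kappa>" and le: "\<kappa> \<le>o \<mu>"
  obtains \<nu> :: "'s rel" where "Card_order \<nu>" "\<nu> =o \<kappa>"
proof -
  have F: "|Field \<kappa>| =o \<kappa>"
    using \<kappa> by (rule card_of_Field_ordIso)
  have "|Field \<kappa>| \<le>o |Field \<mu>|"
    using card_of_mono2[OF le] .
  then obtain h :: "'b \<Rightarrow> 's" where "inj_on h (Field \<kappa>)"
    unfolding card_of_ordLeq[symmetric] by blast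
  then have "|h ` Field \<kappa>| =o |Field \<kappa>|"
    by (metis card_of_ordIsoI inj_on_imp_bij_betw ordIso_symmetric)
  then show thesis
    using that[OF card_of_Card_order] F ordIso_transitive by blast
qed

text \<open>\<open>\<C>\<close> and \<open>\<D>\<close> stand for one spectrum at two types;
  \<open>up\<close> and \<open>down\<close> are its upward closure from \<open>'s\<close> to
  \<open>'b\<close> and back. What needs an argument is that the minimum formed on \<open>'s\<close>
  also bounds the members on \<open>'b\<close>.\<close>

lemma upward_closed_eq_above_min_card:
  fixes \<C> :: "'s rel set" and \<D> :: "'b rel set"
  assumes ne: "\<C> \<noteq> {}"
    and C: "\<And>\<mu>. \<mu> \<in> \<C> \<Longrightarrow> Card_order \<mu>" and D: "\<And>\<kappa>. \<kappa> \<in> \<D> \<Longrightarrow> Card_order \<kappa>"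
    and up: "\<And>\<mu> \<kappa>. \<lbrakk>\<mu> \<in> \<C>; Card_order \<kappa>; \<mu> \<le>o \<kappa>\<rbrakk> \<Longrightarrow> \<kappa> \<in> \<D>"
    and down: "\<And>\<mu> \<kappa>. \<lbrakk>\<kappa> \<in> \<D>; Card_order \<mu>; \<kappa> \<le>o \<mu>\<rbrakk> \<Longrightarrow> \<mu> \<in> \<C>"
  shows "\<D> = {\<kappa>. Card_order \<kappa> \<and> min_card \<C> \<le>o \<kappa>}"
proof (intro Set.set_eqI iffI)
  have min: "min_card \<C> \<in> \<C>" "\<And>\<mu>. \<mu> \<in> \<C> \<Longrightarrow> min_card \<C> \<le>o \<mu>"
    using min_card[OF ne] C by blast+
  show "\<kappa> \<in> \<D>" if "\<kappa> \<in> {\<kappa>. Card_order \<kappa> \<and> min_card \<C> \<le>o \<kappa>}" for \<kappa>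
    using up min(1) that by blast
  show "\<kappa> \<in> {\<kappa>. Card_order \<kappa> \<and> min_card \<C> \<le>o \<kappa>}" if \<kappa>: "\<kappa> \<in> \<D>" for \<kappa>
  proof -
    consider "min_card \<C> \<le>o \<kappa>" | "\<kappa> \<le>o min_card \<C>"
      using ordLeq_total[of "min_card \<C>" \<kappa>] C[OF min(1)] D[OF \<kappa>]
      by (auto simp: card_order_on_def)
    then have "min_card \<C> \<le>o \<kappa>"
    proof cases
      case 2
      \<comment> \<open>A member of \<open>\<D>\<close> at or below the minimum has a copy on
        \<open>'s\<close>. The copy belongs to \<open>\<C>\<close>, so minimality applies to
        it.\<close>
      then obtain \<nu> :: "'s rel" where \<nu>: "Card_order \<nu>" "\<nu> =o \<kappa>"
        using Card_order_copy D[OF \<kappa>] by blast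
      then have "\<nu> \<in> \<C>"
        using down[OF \<kappa>] ordIso_symmetric ordIso_iff_ordLeq by blast
      then show ?thesis
        using min(2) \<nu>(2) ordLeq_ordIso_trans by blast
    qed
    with D[OF \<kappa>] show ?thesis by simp
  qed
qed

lemma Card_order_NSpec:
  shows "\<kappa> \<in> NSpec_fr \<Longrightarrow> Card_order \<kappa>" and "\<kappa> \<in> NSpec_sp \<Longrightarrow> Card_order \<kappa>"
  by (auto simp: NSpec_fr_def NSpec_sp_def)

theorem corollary5p10:
  shows "(\<forall>(\<mu> :: 'a rel) (\<kappa> :: 'b rel).
            \<mu> \<in> NSpec_fr \<and> Card_order \<kappa> \<and> \<mu> \<le>o \<kappa> \<longrightarrow> \<kappa> \<in> NSpec_fr) \<and>
         (\<forall>(\<mu> :: 'a rel) (\<kappa> :: 'b rel).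
            \<mu> \<in> NSpec_sp \<and> Card_order \<kappa> \<and> \<mu> \<le>o \<kappa> \<longrightarrow> \<kappa> \<in> NSpec_sp) \<and>
         ((NSpec_fr :: 's rel set) \<noteq> {} \<longrightarrow>
            NSpec_fr = {\<kappa> :: 'b rel. Card_order \<kappa> \<and> (s_fr :: 's rel) \<le>o \<kappa>}) \<and>
         ((NSpec_sp :: 's rel set) \<noteq> {} \<longrightarrow>
            NSpec_sp = {\<kappa> :: 'b rel. Card_order \<kappa> \<and> (s_sp :: 's rel) \<le>o \<kappa>})"
proof (intro conjI allI impI)
  show "\<kappa> \<in> NSpec_fr" if "\<mu> \<in> NSpec_fr \<and> Card_order \<kappa> \<and> \<mu> \<le>o \<kappa>" for \<mu> :: "'a rel" and \<kappa> :: "'b rel"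
    using that NSpec_fr_upward_closed by blast
  show "\<kappa> \<in> NSpec_sp" if "\<mu> \<in> NSpec_sp \<and> Card_order \<kappa> \<and> \<mu> \<le>o \<kappa>" for \<mu> :: "'a rel" and \<kappa> :: "'b rel"
    using that NSpec_sp_upward_closed by blast
  \<comment> \<open>\<open>up\<close> and \<open>down\<close> are the same polymorphic closure
    lemma, instantiated with \<open>'s\<close> and \<open>'b\<close> in the two orders.\<close>
  show "NSpec_fr = {\<kappa> :: 'b rel. Card_order \<kappa> \<and> (s_fr :: 's rel) \<le>o \<kappa>}"
    if "(NSpec_fr :: 's rel set) \<noteq> {}"
    unfolding s_fr_def using that
    by (rule upward_closed_eq_above_min_card)
      (auto intro: NSpec_fr_upward_closed Card_order_NSpec)
  show "NSpec_sp = {\<kappa> :: 'b rel. Card_order \<kappa> \<and> (s_sp :: 's rel) \<le>o \<kappa>}"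
    if "(NSpec_sp :: 's rel set) \<noteq> {}"
    unfolding s_sp_def using that
    by (rule upward_closed_eq_above_min_card)
      (auto intro: NSpec_sp_upward_closed Card_order_NSpec)
qed

end
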